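(* Let $\mathcal A\in\mathbb K_p^{n\times n}$. Then $\mathcal A$ is reducible if and only if each of the following holds (each of the two conditions being a characterization of reducibility): (1) Every frontal slice $\mathcal A^{(i)}$ is a reducible matrix; more specifically, there exists an $n\times n$ permutation matrix $P$ (the same for all $i$) such that $$P\mathcal A^{(i)}P^{\top}=\begin{bmatrix}\mathcal B^{(i)} & \mathcal C^{(i)}\\ \boldsymbol 0 & \mathcal D^{(i)}\end{bmatrix},\qquad i=1,\dots,p,$$ where the bottom-left block is a zero matrix and $\mathcal B^{(i)},\mathcal D^{(i)}$ are square matrices of size at least $1$, the block sizes being independent of $i$. (2) There exists a permutation tubal matrix $\mathcal P\in\mathbb K_p^{n\times n}$ such that $$\mathcal P*\mathcal A*\mathcal P^{\top}=\begin{bmatrix}\mathcal B & \mathcal C\\ \boldsymbol 0 & \mathcal D\end{bmatrix},$$ where the bottom-left block is a zero tubal matrix and $\mathcal B,\mathcal D$ are square tubal matrices of size at least $1$. That is, the statements "$\mathcal A$ is reducible", (1) and (2) are equivalent.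
   Context: Let $n,p\ge 1$ be integers. $\mathbb K_p=\mathbb R^{1\times1\times p}$ is the set of tubal scalars $\mathbf a$ with entries $\mathbf a^{(1)},\dots,\mathbf a^{(p)}$; the product is circular convolution: $(\mathbf a*\mathbf b)^{(k)}=\sum_{i+j\equiv k+1\ (\mathrm{mod}\ p)}\mathbf a^{(i)}\mathbf b^{(j)}$. A tubal matrix $\mathcal A=(\mathbf a_{i,j})\in\mathbb K_p^{m\times n}=\mathbb R^{m\times n\times p}$ is a matrix with entries in $\mathbb K_p$; its $k$-th frontal slice $\mathcal A^{(k)}$ is the real $m\times n$ matrix with entries $\mathbf a_{i,j}^{(k)}$. The t-product is $(\mathcal A*\mathcal B)_{i,k}=\sum_j \mathbf a_{i,j}*\mathbf b_{j,k}$. The transpose $\mathcal A^{\top}$ has frontal slices, in order, $(\mathcal A^{(1)})^\top,(\mathcal A^{(p)})^\top,(\mathcal A^{(p-1)})^\top,\dots,(\mathcal A^{(2)})^\top$. $\boldsymbol 0$ denotes a zero tubal scalar, vector, matrix, or zero real matrix according to context. A permutation tubal matrix is a $\mathcal P\in\mathbb K_p^{n\times n}$ whose first frontal slice is a permutation matrix and whose other frontal slices are zero. $\mathcal A=(\mathbf a_{i,j})\in\mathbb K_p^{n\times n}$ is reducible if there is a nonempty proper subset $I\subset\{1,\dots,n\}$ with $\mathbf a_{i,j}=\boldsymbol 0$ for all $i\in I$ and all $j\notin I$. *)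

theory Defs
  imports "Jordan_Normal_Form.Matrix"
begin

text \<open>
  A tubal scalar of length \<open>p\<close> is an element of \<open>carrier_vec p\<close>, and a tubal matrix is a
  matrix whose entries are tubal scalars.  All indices start at 0: the \<open>k\<close>-th entry of \<open>a\<close> is
  \<open>a $ (k - 1)\<close>, and the index set \<open>{1,\<dots>,n}\<close> becomes \<open>{..<n}\<close>.
\<close>

type_synonym tubal_scalar = "real vec"
type_synonym tubal_mat = "tubal_scalar mat"

definition carrier_tubal :: "nat \<Rightarrow> nat \<Rightarrow> nat \<Rightarrow> tubal_mat set" where
  "carrier_tubal p m n = {A \<in> carrier_mat m n. \<forall>i<m. \<forall>j<n. A $$ (i,j) \<in> carrier_vec p}"

definition frontal_slice :: "nat \<Rightarrow> tubal_mat \<Rightarrow> real mat" where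
  "frontal_slice k A = map_mat (\<lambda>a. a $ k) A"

text \<open>With indices starting at 1 the summation condition reads \<open>i + j \<equiv> k + 1 (mod p)\<close>;
  shifting all three indices down by one gives the condition below.\<close>

definition tubal_times :: "nat \<Rightarrow> tubal_scalar \<Rightarrow> tubal_scalar \<Rightarrow> tubal_scalar" where
  "tubal_times p a b =
     vec p (\<lambda>k. \<Sum>(i,j)\<in>{(i,j). i < p \<and> j < p \<and> (i + j) mod p = k}. a $ i * b $ j)"

definition t_prod :: "nat \<Rightarrow> tubal_mat \<Rightarrow> tubal_mat \<Rightarrow> tubal_mat" where
  "t_prod p A B = mat (dim_row A) (dim_col B)
     (\<lambda>(i,k). finsum_vec TYPE(real) p (\<lambda>j. tubal_times p (A $$ (i,j)) (B $$ (j,k))) {..<dim_col A})"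

text \<open>Slice 0 of the transpose is the transpose of slice 0, and slice \<open>k > 0\<close> is the transpose
  of slice \<open>p - k\<close>; see \<open>frontal_slice_t_transpose\<close>.\<close>

definition t_transpose :: "nat \<Rightarrow> tubal_mat \<Rightarrow> tubal_mat" where
  "t_transpose p A = mat (dim_col A) (dim_row A)
     (\<lambda>(i,j). vec p (\<lambda>k. A $$ (j,i) $ ((p - k) mod p)))"

definition zero_tubal_mat :: "nat \<Rightarrow> nat \<Rightarrow> nat \<Rightarrow> tubal_mat" where
  "zero_tubal_mat p m n = mat m n (\<lambda>_. 0\<^sub>v p)"

definition permutation_mat :: "nat \<Rightarrow> real mat \<Rightarrow> bool" where
  "permutation_mat n P \<longleftrightarrow> P \<in> carrier_mat n n \<and>
     (\<forall>i<n. \<forall>j<n. P $$ (i,j) \<in> {0, 1}) \<and>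
     (\<forall>i<n. \<exists>!j. j < n \<and> P $$ (i,j) = 1) \<and>
     (\<forall>j<n. \<exists>!i. i < n \<and> P $$ (i,j) = 1)"

definition permutation_tubal_mat :: "nat \<Rightarrow> nat \<Rightarrow> tubal_mat \<Rightarrow> bool" where
  "permutation_tubal_mat p n P \<longleftrightarrow> P \<in> carrier_tubal p n n \<and>
     permutation_mat n (frontal_slice 0 P) \<and>
     (\<forall>k. 0 < k \<and> k < p \<longrightarrow> frontal_slice k P = 0\<^sub>m n n)"

definition reducible_mat :: "nat \<Rightarrow> real mat \<Rightarrow> bool" where
  "reducible_mat n A \<longleftrightarrow>
     (\<exists>I. I \<noteq> {} \<and> I \<subset> {..<n} \<and> (\<forall>i\<in>I. \<forall>j\<in>{..<n} - I. A $$ (i,j) = 0))"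

definition reducible_tubal_mat :: "nat \<Rightarrow> nat \<Rightarrow> tubal_mat \<Rightarrow> bool" where
  "reducible_tubal_mat p n A \<longleftrightarrow>
     (\<exists>I. I \<noteq> {} \<and> I \<subset> {..<n} \<and> (\<forall>i\<in>I. \<forall>j\<in>{..<n} - I. A $$ (i,j) = 0\<^sub>v p))"

lemma frontal_slice_carrier:
  "A \<in> carrier_tubal p m n \<Longrightarrow> frontal_slice k A \<in> carrier_mat m n"
  by (auto simp: carrier_tubal_def frontal_slice_def)

lemma t_transpose_carrier:
  "A \<in> carrier_tubal p m n \<Longrightarrow> t_transpose p A \<in> carrier_tubal p n m"
  by (auto simp: carrier_tubal_def t_transpose_def)

lemma t_prod_carrier:
  assumes "A \<in> carrier_tubal p l m" and "B \<in> carrier_tubal p m n"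
  shows "t_prod p A B \<in> carrier_tubal p l n"
  using assms by (auto simp: carrier_tubal_def t_prod_def tubal_times_def intro!: finsum_vec_closed)

lemma frontal_slice_t_transpose:
  assumes "A \<in> carrier_tubal p m n" and "k < p"
  shows "frontal_slice k (t_transpose p A) =
           transpose_mat (frontal_slice (if k = 0 then 0 else p - k) A)"
  using assms by (intro eq_matI) (auto simp: carrier_tubal_def frontal_slice_def t_transpose_def)

end

theory Submission
  imports Defs
begin

text \<open>
  A permutation matrix, real or tubal, amounts to a permutation \<open>f\<close> of \<open>{..<n}\<close>, and conjugating \<open>M\<close>
  by it yields the matrix with entries \<open>M $$ (f i, f j)\<close>; in the tubal case this is because
  \<open>unit_vec p 0\<close> is the unit of circular convolution and is fixed by the transpose. Hence the
  lower left block vanishes iff \<open>a\<^sub>i\<^sub>j = 0\<close> whenever \<open>i\<close> lies in the image \<open>I\<close> of the last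
  \<open>s\<close> indices and \<open>j\<close> outside of it, and every nonempty proper \<open>I\<close> arises as such an image.
\<close>

section \<open>Permutation matrices as bijections of the index set\<close>

text \<open>The two entries are parameters so that one shape covers the real case, with
  \<open>1\<close> and \<open>0\<close>, and the tubal case, with \<open>unit_vec p 0\<close> and
  \<open>0\<^sub>v p\<close>.\<close>

definition perm_mat_of :: "nat \<Rightarrow> 'a \<Rightarrow> 'a \<Rightarrow> (nat \<Rightarrow> nat) \<Rightarrow> 'a mat" where
  "perm_mat_of n u z f = mat n n (\<lambda>(i,j). if j = f i then u else z)"

text \<open>The row condition makes the position of the one in row \<open>i\<close> a function
  \<open>f\<close>, and uniqueness in each column makes \<open>f\<close> injective, hence bijective
  on a finite set. Conversely, surjectivity of \<open>f\<close> puts a one in every column and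
  injectivity makes it unique.\<close>

lemma permutation_mat_iff:
  "permutation_mat n P \<longleftrightarrow> (\<exists>f. bij_betw f {..<n} {..<n} \<and> P = perm_mat_of n 1 0 f)"
proof
  assume P: "permutation_mat n P"
  define f where "f i = (THE j. j < n \<and> P $$ (i,j) = 1)" for i
  have row: "\<exists>!j. j < n \<and> P $$ (i,j) = 1" and col: "\<exists>!k. k < n \<and> P $$ (k,i) = 1" if "i < n" for i
    using P that by (simp_all add: permutation_mat_def)
  have f: "f i < n \<and> P $$ (i, f i) = 1" if "i < n" for i
    unfolding f_def using theI'[OF row[OF that]] .
  have f_unique: "j = f i" if "i < n" "j < n" "P $$ (i,j) = 1" for i j
    unfolding f_def using the1_equality[OF row[OF that(1)]] that(2,3) by simp
  have "inj_on f {..<n}"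
  proof (rule inj_onI)
    fix i i' assume "i \<in> {..<n}" "i' \<in> {..<n}" "f i = f i'"
    then have "f i < n" "i < n \<and> P $$ (i, f i) = 1" "i' < n \<and> P $$ (i', f i) = 1"
      using f[of i] f[of i'] by auto
    then show "i = i'"
      using the1_equality[OF col[of "f i"], of i] the1_equality[OF col[of "f i"], of i'] by simp
  qed
  moreover have "f ` {..<n} \<subseteq> {..<n}"
    using f by auto
  ultimately have "bij_betw f {..<n} {..<n}"
    by (simp add: bij_betw_def endo_inj_surj)
  moreover have "P = perm_mat_of n 1 0 f"
  proof (rule eq_matI)
    fix i j assume "i < dim_row (perm_mat_of n 1 0 f :: real mat)"
      "j < dim_col (perm_mat_of n 1 0 f :: real mat)"
    then have ij: "i < n" "j < n" by (auto simp: perm_mat_of_def)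
    then have "P $$ (i,j) \<in> {0, 1}"
      using P by (simp add: permutation_mat_def)
    \<comment> \<open>The entries are 0 or 1, so the positions of the ones determine the
      matrix.\<close>
    moreover have "P $$ (i,j) = 1 \<longleftrightarrow> j = f i"
      using f[OF ij(1)] f_unique[OF ij] by blast
    ultimately have "P $$ (i,j) = (if j = f i then 1 else 0)"
      by auto
    then show "P $$ (i,j) = perm_mat_of n 1 0 f $$ (i,j)"
      using ij by (simp add: perm_mat_of_def)
  qed (use P in \<open>auto simp: permutation_mat_def perm_mat_of_def\<close>)
  ultimately show "\<exists>f. bij_betw f {..<n} {..<n} \<and> P = perm_mat_of n 1 0 f"
    by blast
next
  assume "\<exists>f. bij_betw f {..<n} {..<n} \<and> P = perm_mat_of n 1 0 f"
  then obtain f where f: "bij_betw f {..<n} {..<n}" and P: "P = perm_mat_of n 1 0 f"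
    by blast
  have P_eq: "P $$ (i,j) = 1 \<longleftrightarrow> j = f i" if "i < n" "j < n" for i j
    using that by (simp add: P perm_mat_of_def)
  have "\<exists>!j. j < n \<and> P $$ (i,j) = 1" if "i < n" for i
    using bij_betwE[OF f] that by (intro ex1I[of _ "f i"]) (auto simp: P_eq)
  moreover have "\<exists>!i. i < n \<and> P $$ (i,j) = 1" if j: "j < n" for j
  proof -
    have "j \<in> f ` {..<n}"
      using f j by (simp add: bij_betw_def)
    then obtain i where i: "i < n" "j = f i"
      by blast
    show ?thesis
    proof (rule ex1I[of _ i])
      show "i < n \<and> P $$ (i,j) = 1"
        using i j by (simp add: P_eq)
    next
      fix k assume "k < n \<and> P $$ (k,j) = 1"
      then have "k < n" "f k = f i"
        using i j P_eq[of k j] by auto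
      then show "k = i"
        using i inj_onD[OF bij_betw_imp_inj_on[OF f], of k i] by simp
    qed
  qed
  ultimately show "permutation_mat n P"
    by (auto simp: permutation_mat_def P perm_mat_of_def)
qed

text \<open>Slice 0 fixes the leading coordinate of each entry and the other slices force all later
  coordinates to vanish, which leaves only \<open>unit_vec p 0\<close> and the zero scalar. The
  bound on \<open>p\<close> ensures that coordinate 0 exists.\<close>

lemma permutation_tubal_mat_iff:
  assumes "p \<ge> 1"
  shows "permutation_tubal_mat p n P \<longleftrightarrow>
    (\<exists>f. bij_betw f {..<n} {..<n} \<and> P = perm_mat_of n (unit_vec p 0) (0\<^sub>v p) f)"
proof
  assume P: "permutation_tubal_mat p n P"
  then obtain f where f: "bij_betw f {..<n} {..<n}"
    and slice: "frontal_slice 0 P = perm_mat_of n 1 0 f"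
    unfolding permutation_tubal_mat_def permutation_mat_iff by blast
  have dim: "dim_row P = n" "dim_col P = n"
    and vec: "\<And>i j. i < n \<Longrightarrow> j < n \<Longrightarrow> P $$ (i,j) \<in> carrier_vec p"
    and rest: "\<And>k. 0 < k \<Longrightarrow> k < p \<Longrightarrow> frontal_slice k P = 0\<^sub>m n n"
    using P by (auto simp: permutation_tubal_mat_def carrier_tubal_def)
  have "P = perm_mat_of n (unit_vec p 0) (0\<^sub>v p) f"
  proof (rule eq_matI)
    fix i j
    assume "i < dim_row (perm_mat_of n (unit_vec p 0 :: real vec) (0\<^sub>v p) f)"
      "j < dim_col (perm_mat_of n (unit_vec p 0 :: real vec) (0\<^sub>v p) f)"
    then have ij: "i < n" "j < n" by (auto simp: perm_mat_of_def)
    have "P $$ (i,j) $ 0 = (if j = f i then 1 else 0)"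
      using arg_cong[OF slice, of "\<lambda>M. M $$ (i,j)"] ij dim
      by (simp add: frontal_slice_def perm_mat_of_def)
    moreover have "P $$ (i,j) $ k = 0" if "0 < k" "k < p" for k
      using arg_cong[OF rest[OF that], of "\<lambda>M. M $$ (i,j)"] ij dim
      by (simp add: frontal_slice_def)
    ultimately have "P $$ (i,j) $ k = (if j = f i then unit_vec p 0 else 0\<^sub>v p) $ k" if "k < p" for k
      using that by (cases "k = 0") auto
    then show "P $$ (i,j) = perm_mat_of n (unit_vec p 0) (0\<^sub>v p) f $$ (i,j)"
      using ij vec[OF ij] by (intro eq_vecI) (auto simp: perm_mat_of_def)
  qed (auto simp: dim perm_mat_of_def)
  with f show "\<exists>f. bij_betw f {..<n} {..<n} \<and> P = perm_mat_of n (unit_vec p 0) (0\<^sub>v p) f"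
    by blast
next
  assume "\<exists>f. bij_betw f {..<n} {..<n} \<and> P = perm_mat_of n (unit_vec p 0) (0\<^sub>v p) f"
  then obtain f where f: "bij_betw f {..<n} {..<n}"
    and P: "P = perm_mat_of n (unit_vec p 0) (0\<^sub>v p) f"
    by blast
  have "frontal_slice 0 P = perm_mat_of n 1 0 f"
    using assms by (intro eq_matI) (auto simp: P perm_mat_of_def frontal_slice_def)
  with f have "permutation_mat n (frontal_slice 0 P)"
    using permutation_mat_iff by blast
  moreover have "frontal_slice k P = 0\<^sub>m n n" if "0 < k" "k < p" for k
    using that by (intro eq_matI) (auto simp: P perm_mat_of_def frontal_slice_def)
  ultimately show "permutation_tubal_mat p n P"
    by (auto simp: permutation_tubal_mat_def carrier_tubal_def P perm_mat_of_def)
qed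

section \<open>Conjugation by a permutation, real and tubal\<close>

text \<open>Row \<open>i\<close> of the permutation matrix has its one in column \<open>f i\<close>,
  so each sum collapses to one term: the left factor selects row \<open>f i\<close>, and the
  transposed right factor selects column \<open>f j\<close>.\<close>

lemma conj_perm_mat_of:
  fixes M :: "'a :: comm_semiring_1 mat"
  assumes "bij_betw f {..<n} {..<n}" and "M \<in> carrier_mat n n"
  shows "perm_mat_of n 1 0 f * M * transpose_mat (perm_mat_of n 1 0 f) =
    mat n n (\<lambda>(i,j). M $$ (f i, f j))"
proof -
  have f: "f i < n" if "i < n" for i
    using bij_betwE[OF assms(1)] that by auto
  have left: "perm_mat_of n 1 0 f * M = mat n n (\<lambda>(i,j). M $$ (f i, j))"
    using assms(2) f
    by (intro eq_matI)
      (auto simp: perm_mat_of_def scalar_prod_def if_distrib[of "\<lambda>x. x * _"] sum.delta cong: if_cong)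
  show ?thesis
    unfolding left using f
    by (intro eq_matI)
      (auto simp: perm_mat_of_def scalar_prod_def if_distrib[of "\<lambda>x. _ * x"] sum.delta cong: if_cong)
qed

text \<open>Allows the unit and zero laws, stated for the left factor, to be applied to a
  permutation entry on the right.\<close>

lemma tubal_times_comm: "tubal_times p a b = tubal_times p b a"
  unfolding tubal_times_def
  by (intro eq_vecI, simp_all)
    (rule sum.reindex_bij_witness[of _ prod.swap prod.swap], auto simp: add.commute)

lemma tubal_times_unit_left:
  assumes "a \<in> carrier_vec p"
  shows "tubal_times p (unit_vec p 0) a = a"
proof (rule eq_vecI)
  fix k assume "k < dim_vec a"
  then have k: "k < p" using assms by auto
  let ?S = "{(i,j). i < p \<and> j < p \<and> (i + j) mod p = k}"
  have "finite ?S"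
    by (rule finite_subset[of _ "{..<p} \<times> {..<p}"]) auto
  have "tubal_times p (unit_vec p 0) a $ k = (\<Sum>(i,j)\<in>?S. unit_vec p 0 $ i * a $ j)"
    using k by (simp add: tubal_times_def)
  \<comment> \<open>With first index 0 the congruence reads \<open>j mod p = k\<close>, so
    \<open>j = k\<close> because \<open>j < p\<close>; only the pair \<open>(0,k)\<close>
    contributes.\<close>
  also have "\<dots> = (\<Sum>x\<in>?S. if x = (0,k) then a $ k else 0)"
    using k by (intro sum.cong) (auto simp: unit_vec_def split: if_splits)
  also have "\<dots> = a $ k"
    using \<open>finite ?S\<close> k by (subst sum.delta) auto
  finally show "tubal_times p (unit_vec p 0) a $ k = a $ k" .
qed (use assms in \<open>auto simp: tubal_times_def\<close>)

lemma tubal_times_zero_left: "tubal_times p (0\<^sub>v p) a = 0\<^sub>v p"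
  by (intro eq_vecI) (auto simp: tubal_times_def intro!: sum.neutral)

text \<open>The counterpart of \<open>sum.delta\<close> for vector sums, obtained coordinate by
  coordinate; it collapses the sums in \<open>t_prod\<close>.\<close>

lemma finsum_vec_single:
  assumes "finite S" and "l \<in> S" and "b \<in> carrier_vec p"
    and g: "\<And>j. j \<in> S \<Longrightarrow> g j = (if j = l then b else 0\<^sub>v p)"
  shows "finsum_vec TYPE('a :: comm_monoid_add) p g S = b"
proof (rule eq_vecI)
  have closed: "g \<in> S \<rightarrow> carrier_vec p"
    using assms by auto
  then show "dim_vec (finsum_vec TYPE('a) p g S) = dim_vec b"
    using assms(3) finsum_vec_closed[OF closed] by auto
  fix k assume "k < dim_vec b"
  then have k: "k < p" using assms by auto
  have "finsum_vec TYPE('a) p g S $ k = (\<Sum>j\<in>S. g j $ k)"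
    using assms(1) k closed by (intro index_finsum_vec) auto
  also have "\<dots> = (\<Sum>j\<in>S. if j = l then b $ k else 0)"
    using k g by (intro sum.cong) auto
  also have "\<dots> = b $ k"
    using assms by simp
  finally show "finsum_vec TYPE('a) p g S $ k = b $ k" .
qed

text \<open>The same selection of rows and then columns as for real matrices, carried out for
  \<open>t_prod\<close>, whose sums are vector sums of convolutions.\<close>

lemma t_conj_perm_mat_of:
  assumes "bij_betw f {..<n} {..<n}" and "M \<in> carrier_tubal p n n" and "p \<ge> 1"
  defines "P \<equiv> perm_mat_of n (unit_vec p 0) (0\<^sub>v p) f"
  shows "t_prod p (t_prod p P M) (t_transpose p P) = mat n n (\<lambda>(i,j). M $$ (f i, f j))"
proof -
  have f: "f i < n" if "i < n" for i
    using bij_betwE[OF assms(1)] that by auto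
  have M: "M $$ (i,j) \<in> carrier_vec p" if "i < n" "j < n" for i j
    using assms(2) that by (auto simp: carrier_tubal_def)
  have dimM: "dim_row M = n" "dim_col M = n"
    using assms(2) by (auto simp: carrier_tubal_def)
  have left: "t_prod p P M = mat n n (\<lambda>(i,k). M $$ (f i, k))"
  proof (rule eq_matI)
    fix i k
    assume "i < dim_row (mat n n (\<lambda>(i,k). M $$ (f i, k)))"
      "k < dim_col (mat n n (\<lambda>(i,k). M $$ (f i, k)))"
    then have ik: "i < n" "k < n" by auto
    have "t_prod p P M $$ (i,k) =
      finsum_vec TYPE(real) p (\<lambda>j. tubal_times p (P $$ (i,j)) (M $$ (j,k))) {..<n}"
      using ik dimM by (simp add: t_prod_def P_def perm_mat_of_def)
    also have "\<dots> = M $$ (f i, k)"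
      using ik M f
      by (intro finsum_vec_single[where l = "f i"])
        (auto simp: P_def perm_mat_of_def tubal_times_unit_left tubal_times_zero_left)
    finally show "t_prod p P M $$ (i,k) = mat n n (\<lambda>(i,k). M $$ (f i, k)) $$ (i,k)"
      using ik by simp
  qed (auto simp: t_prod_def P_def perm_mat_of_def dimM)
  have dim_transpose: "dim_row (t_transpose p P) = n" "dim_col (t_transpose p P) = n"
    by (simp_all add: t_transpose_def P_def perm_mat_of_def)
  have transpose: "t_transpose p P $$ (j,k) = (if j = f k then unit_vec p 0 else 0\<^sub>v p)"
    if "j < n" "k < n" for j k
  proof -
    \<comment> \<open>Transposition reverses the coordinates cyclically. This reversal fixes
      position 0 and no other position is sent there, so \<open>unit_vec p 0\<close> is
      unchanged.\<close>
    have "(p - l) mod p = 0 \<longleftrightarrow> l = 0" if "l < p" for l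
      using that by (cases "l = 0") auto
    then show ?thesis
      using that \<open>p \<ge> 1\<close>
      by (intro eq_vecI) (auto simp: t_transpose_def P_def perm_mat_of_def unit_vec_def)
  qed
  show ?thesis
    unfolding left
  proof (rule eq_matI)
    fix i k
    assume "i < dim_row (mat n n (\<lambda>(i,j). M $$ (f i, f j)))"
      "k < dim_col (mat n n (\<lambda>(i,j). M $$ (f i, f j)))"
    then have ik: "i < n" "k < n" by auto
    let ?L = "mat n n (\<lambda>(i,k). M $$ (f i, k))"
    have "t_prod p ?L (t_transpose p P) $$ (i,k) =
      finsum_vec TYPE(real) p (\<lambda>j. tubal_times p (?L $$ (i,j)) (t_transpose p P $$ (j,k))) {..<n}"
      using ik dim_transpose by (simp add: t_prod_def)
    \<comment> \<open>The permutation entry is now the right factor; commutativity, instantiated at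
      entries of \<open>M\<close>, brings it to the left.\<close>
    also have "\<dots> = M $$ (f i, f k)"
      using ik M f
      by (intro finsum_vec_single[where l = "f k"])
        (auto simp: transpose tubal_times_comm[of p "M $$ _"] tubal_times_unit_left
          tubal_times_zero_left)
    finally show "t_prod p (mat n n (\<lambda>(i,k). M $$ (f i, k))) (t_transpose p P) $$ (i,k) =
      mat n n (\<lambda>(i,j). M $$ (f i, f j)) $$ (i,k)"
      using ik by simp
  qed (auto simp: t_prod_def t_transpose_def P_def perm_mat_of_def)
qed

section \<open>Index sets as images of final segments\<close>

text \<open>Two bijections are glued: the first \<open>n - card I\<close> indices go onto the
  complement of \<open>I\<close>, the remaining ones onto \<open>I\<close>. The set \<open>I\<close>
  comes last because its rows are to form the bottom of the block matrix.\<close>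

lemma exists_bij_betw_final_segment:
  assumes "I \<subseteq> {..<n}"
  obtains f where "bij_betw f {..<n} {..<n}" and "f ` {n - card I..<n} = I"
proof -
  have fin: "finite I" using assms finite_subset by blast
  let ?r = "n - card I"
  have card_le: "card I \<le> n" using card_mono[OF _ assms] by simp
  have "card {..<?r} = card ({..<n} - I)"
    using assms fin by (simp add: card_Diff_subset)
  then obtain g where g: "bij_betw g {..<?r} ({..<n} - I)"
    using finite_same_card_bij[of "{..<?r}" "{..<n} - I"] by auto
  have "card {?r..<n} = card I" using card_le by simp
  then obtain h where h: "bij_betw h {?r..<n} I"
    using finite_same_card_bij[of "{?r..<n}" I] fin by auto
  let ?f = "\<lambda>i. if i \<in> {..<?r} then g i else h i"
  have "bij_betw ?f ({..<?r} \<union> {?r..<n}) (({..<n} - I) \<union> I)"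
    by (rule bij_betw_disjoint_Un[OF g h]) auto
  moreover have "{..<?r} \<union> {?r..<n} = {..<n}" "({..<n} - I) \<union> I = {..<n}"
    using assms by auto
  moreover have "?f ` {?r..<n} = h ` {?r..<n}"
    by (intro image_cong) auto
  moreover have "h ` {?r..<n} = I"
    using h by (simp add: bij_betw_def)
  ultimately show thesis using that[of ?f] by simp
qed

text \<open>The combinatorial core, where \<open>Z i j\<close> stands for the vanishing of the entry
  at \<open>(i,j)\<close>. Here \<open>s\<close> is the size of \<open>I\<close> and
  \<open>r\<close> that of its complement, so \<open>s \<ge> 1\<close> expresses that
  \<open>I\<close> is nonempty and \<open>r \<ge> 1\<close> that it is proper.\<close>

lemma index_set_iff_bij:
  fixes n :: nat
  shows "(\<exists>I. I \<noteq> {} \<and> I \<subset> {..<n} \<and> (\<forall>i\<in>I. \<forall>j\<in>{..<n} - I. Z i j)) \<longleftrightarrow>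
   (\<exists>f r s. bij_betw f {..<n} {..<n} \<and> r \<ge> 1 \<and> s \<ge> 1 \<and> r + s = n \<and>
      (\<forall>i<s. \<forall>j<r. Z (f (i + r)) (f j)))"
  (is "?L \<longleftrightarrow> ?R")
proof
  assume ?L
  then obtain I where I: "I \<noteq> {}" "I \<subset> {..<n}" and Z: "\<And>i j. i \<in> I \<Longrightarrow> j \<in> {..<n} - I \<Longrightarrow> Z i j"
    by blast
  obtain f where f: "bij_betw f {..<n} {..<n}" and fI: "f ` {n - card I..<n} = I"
    using exists_bij_betw_final_segment[of I n] I by blast
  have card: "1 \<le> card I" "card I < n"
    using I psubset_card_mono[OF _ I(2)] finite_subset[of I "{..<n}"]
    by (auto simp: Suc_le_eq card_gt_0_iff)
  have "Z (f (i + (n - card I))) (f j)" if "i < card I" "j < n - card I" for i j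
  proof (rule Z)
    have "f (i + (n - card I)) \<in> f ` {n - card I..<n}"
      using that card by (intro imageI) auto
    then show "f (i + (n - card I)) \<in> I"
      by (simp only: fI)
    have "f j \<notin> f ` {n - card I..<n}"
      using that by (subst inj_on_image_mem_iff[OF bij_betw_imp_inj_on[OF f]]) auto
    then show "f j \<in> {..<n} - I"
      using that bij_betwE[OF f] by (simp only: fI) auto
  qed
  with f card show ?R
    by (intro exI[of _ f] exI[of _ "n - card I"] exI[of _ "card I"]) auto
next
  assume ?R
  then obtain f r s where f: "bij_betw f {..<n} {..<n}" and rs: "r \<ge> 1" "s \<ge> 1" "r + s = n"
    and Z: "\<And>i j. i < s \<Longrightarrow> j < r \<Longrightarrow> Z (f (i + r)) (f j)"
    by blast
  let ?I = "f ` {r..<n}"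
  \<comment> \<open>Since \<open>r \<ge> 1\<close> and \<open>f\<close> is injective,
    \<open>f 0\<close> witnesses that the image is a proper subset.\<close>
  have "f 0 \<notin> ?I"
    using rs by (subst inj_on_image_mem_iff[OF bij_betw_imp_inj_on[OF f]]) auto
  moreover have "f 0 < n"
    using rs bij_betwE[OF f] by auto
  moreover have "?I \<subseteq> {..<n}"
    using bij_betwE[OF f] by auto
  ultimately have "?I \<subset> {..<n}" by blast
  moreover have "?I \<noteq> {}" using rs by auto
  moreover have "Z a b" if ab: "a \<in> ?I" "b \<in> {..<n} - ?I" for a b
  proof -
    obtain i where i: "r \<le> i" "i < n" "a = f i" using ab by auto
    have "b \<in> f ` {..<n}" using f ab by (simp add: bij_betw_def)
    then obtain j where j: "j < n" "b = f j" by blast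
    \<comment> \<open>An index \<open>j \<ge> r\<close> would put \<open>b\<close> into the
      image.\<close>
    with ab have "j < r" by force
    then show ?thesis using Z[of "i - r" j] i j rs by auto
  qed
  ultimately show ?L
    by (intro exI[of _ ?I] conjI ballI) simp_all
qed

section \<open>Block triangular shape in terms of entries\<close>

lemma lower_left_of_four_block_mat:
  assumes "B \<in> carrier_mat r r" and "D \<in> carrier_mat s s" and "i < s" and "j < r"
  shows "four_block_mat B C Z D $$ (i + r, j) = Z $$ (i,j)"
  using assms by (auto simp: four_block_mat_def Let_def)

text \<open>Three blocks are cut out of \<open>M\<close>, while the lower left one is prescribed and
  only compared with \<open>M\<close> entrywise. The entry type is arbitrary, so real and tubal
  matrices are both covered.\<close>

lemma four_block_mat_decompose:
  assumes "M \<in> carrier_mat (r + s) (r + s)"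
    and "\<And>i j. i < s \<Longrightarrow> j < r \<Longrightarrow> M $$ (i + r, j) = Z $$ (i,j)"
  shows "M = four_block_mat (mat r r (\<lambda>(i,j). M $$ (i,j))) (mat r s (\<lambda>(i,j). M $$ (i, j + r)))
    Z (mat s s (\<lambda>(i,j). M $$ (i + r, j + r)))"
proof (rule eq_matI, goal_cases)
  case (1 i j)
  then have "i < r + s" "j < r + s" by (auto simp: four_block_mat_def)
  then show ?case
    using assms(2)[of "i - r" j] by (auto simp: four_block_mat_def Let_def)
qed (use assms(1) in \<open>auto simp: four_block_mat_def Let_def\<close>)

text \<open>The other three blocks are constrained only in size and can always be cut out of
  \<open>M\<close>, so the block equation amounts to the vanishing of the lower left
  entries.\<close>

lemma real_block_triangular_iff:
  assumes "M \<in> carrier_mat (r + s) (r + s)"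
  shows "(\<exists>B C D. B \<in> carrier_mat r r \<and> C \<in> carrier_mat r s \<and> D \<in> carrier_mat s s \<and>
      M = four_block_mat B C (0\<^sub>m s r) D) \<longleftrightarrow>
    (\<forall>i<s. \<forall>j<r. M $$ (i + r, j) = 0)" (is "?L \<longleftrightarrow> ?R")
proof
  assume ?L
  then show ?R by (auto simp: lower_left_of_four_block_mat simp del: index_mat_four_block)
next
  assume ?R
  then have "M = four_block_mat (mat r r (\<lambda>(i,j). M $$ (i,j))) (mat r s (\<lambda>(i,j). M $$ (i, j + r)))
    (0\<^sub>m s r) (mat s s (\<lambda>(i,j). M $$ (i + r, j + r)))"
    by (intro four_block_mat_decompose[OF assms]) auto
  then show ?L by (meson mat_carrier)
qed

lemma tubal_block_triangular_iff:
  assumes "M \<in> carrier_tubal p (r + s) (r + s)"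
  shows "(\<exists>B C D. B \<in> carrier_tubal p r r \<and> C \<in> carrier_tubal p r s \<and> D \<in> carrier_tubal p s s \<and>
      M = four_block_mat B C (zero_tubal_mat p s r) D) \<longleftrightarrow>
    (\<forall>i<s. \<forall>j<r. M $$ (i + r, j) = 0\<^sub>v p)" (is "?L \<longleftrightarrow> ?R")
proof
  assume ?L
  then show ?R
    by (auto simp: lower_left_of_four_block_mat carrier_tubal_def zero_tubal_mat_def
        simp del: index_mat_four_block)
next
  assume R: ?R
  let ?B = "mat r r (\<lambda>(i,j). M $$ (i,j))" and ?C = "mat r s (\<lambda>(i,j). M $$ (i, j + r))"
    and ?D = "mat s s (\<lambda>(i,j). M $$ (i + r, j + r))"
  have "M = four_block_mat ?B ?C (zero_tubal_mat p s r) ?D"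
    using assms R by (intro four_block_mat_decompose) (auto simp: carrier_tubal_def zero_tubal_mat_def)
  moreover have "?B \<in> carrier_tubal p r r" "?C \<in> carrier_tubal p r s" "?D \<in> carrier_tubal p s s"
    using assms by (auto simp: carrier_tubal_def)
  ultimately show ?L by blast
qed

section \<open>Both characterizations of reducibility\<close>

theorem theorem3p1:
  fixes n p :: nat and A :: tubal_mat
  assumes "n \<ge> 1" and "p \<ge> 1"
    and "A \<in> carrier_tubal p n n"
  shows "(reducible_tubal_mat p n A \<longleftrightarrow>
            (\<forall>k<p. reducible_mat n (frontal_slice k A)) \<and>
            (\<exists>P r s. permutation_mat n P \<and> r \<ge> 1 \<and> s \<ge> 1 \<and> r + s = n \<and>
              (\<forall>k<p. \<exists>B C D.
                 B \<in> carrier_mat r r \<and> C \<in> carrier_mat r s \<and> D \<in> carrier_mat s s \<and>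
                 P * frontal_slice k A * transpose_mat P = four_block_mat B C (0\<^sub>m s r) D))) \<and>
         (reducible_tubal_mat p n A \<longleftrightarrow>
            (\<exists>P r s B C D. permutation_tubal_mat p n P \<and> r \<ge> 1 \<and> s \<ge> 1 \<and> r + s = n \<and>
               B \<in> carrier_tubal p r r \<and> C \<in> carrier_tubal p r s \<and> D \<in> carrier_tubal p s s \<and>
               t_prod p (t_prod p P A) (t_transpose p P) =
                 four_block_mat B C (zero_tubal_mat p s r) D))"
proof -
  \<comment> \<open>The common middle term: for fixed \<open>f\<close>, \<open>r\<close> and
    \<open>s\<close>, both block conditions will be shown equivalent to it.\<close>
  let ?zeros = "\<lambda>f r s. \<forall>i<s. \<forall>j<r. A $$ (f (i + r), f j) = 0\<^sub>v p"
  have dim: "dim_row A = n" "dim_col A = n"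
    and vec: "\<And>i j. i < n \<Longrightarrow> j < n \<Longrightarrow> A $$ (i,j) \<in> carrier_vec p"
    using assms(3) by (auto simp: carrier_tubal_def)
  have zero_iff: "A $$ (i,j) = 0\<^sub>v p \<longleftrightarrow> (\<forall>k<p. A $$ (i,j) $ k = 0)" if "i < n" "j < n" for i j
    using vec[OF that] by (auto simp: vec_eq_iff)
  have reducible_iff: "reducible_tubal_mat p n A \<longleftrightarrow>
    (\<exists>f r s. bij_betw f {..<n} {..<n} \<and> r \<ge> 1 \<and> s \<ge> 1 \<and> r + s = n \<and> ?zeros f r s)"
    unfolding reducible_tubal_mat_def by (rule index_set_iff_bij)
  \<comment> \<open>One set \<open>I\<close> for \<open>A\<close> serves every slice. The converse
    fails in general, since different slices may need different sets; the way back uses the common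
    permutation instead.\<close>
  have slices_reducible: "\<forall>k<p. reducible_mat n (frontal_slice k A)"
    if red: "reducible_tubal_mat p n A"
  proof (intro allI impI)
    fix k assume k: "k < p"
    obtain I where I: "I \<noteq> {}" "I \<subset> {..<n}" "\<forall>i\<in>I. \<forall>j\<in>{..<n} - I. A $$ (i,j) = 0\<^sub>v p"
      using red unfolding reducible_tubal_mat_def by blast
    have "frontal_slice k A $$ (i,j) = 0" if "i \<in> I" "j \<in> {..<n} - I" for i j
    proof -
      have "i < n" "j < n" using that I(2) by auto
      then show ?thesis using that I(3) k by (simp add: frontal_slice_def dim)
    qed
    with I show "reducible_mat n (frontal_slice k A)"
      unfolding reducible_mat_def by (intro exI[of _ I] conjI ballI) simp_all
  qed
  have slice_blocks: "(\<forall>k<p. \<exists>B C D.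
       B \<in> carrier_mat r r \<and> C \<in> carrier_mat r s \<and> D \<in> carrier_mat s s \<and>
       perm_mat_of n 1 0 f * frontal_slice k A * transpose_mat (perm_mat_of n 1 0 f) =
         four_block_mat B C (0\<^sub>m s r) D) \<longleftrightarrow> ?zeros f r s"
    if f: "bij_betw f {..<n} {..<n}" and rs: "r + s = n" for f r s
  proof -
    have fn: "f i < n" if "i < n" for i using bij_betwE[OF f] that by auto
    have "(\<exists>B C D.
       B \<in> carrier_mat r r \<and> C \<in> carrier_mat r s \<and> D \<in> carrier_mat s s \<and>
       perm_mat_of n 1 0 f * frontal_slice k A * transpose_mat (perm_mat_of n 1 0 f) =
         four_block_mat B C (0\<^sub>m s r) D) \<longleftrightarrow>
       (\<forall>i<s. \<forall>j<r. A $$ (f (i + r), f j) $ k = 0)" for k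
      unfolding conj_perm_mat_of[OF f frontal_slice_carrier[OF assms(3)]]
      using fn rs by (subst real_block_triangular_iff) (auto simp: frontal_slice_def dim)
    \<comment> \<open>A tubal entry vanishes iff all its coordinates do. As \<open>f\<close>,
      \<open>r\<close> and \<open>s\<close> do not depend on \<open>k\<close>, the quantifier over
      slices can be moved to the front.\<close>
    moreover have "?zeros f r s \<longleftrightarrow> (\<forall>k<p. \<forall>i<s. \<forall>j<r. A $$ (f (i + r), f j) $ k = 0)"
      using zero_iff fn rs by auto
    ultimately show ?thesis by simp
  qed
  have tubal_blocks: "(\<exists>B C D.
       B \<in> carrier_tubal p r r \<and> C \<in> carrier_tubal p r s \<and> D \<in> carrier_tubal p s s \<and>
       t_prod p (t_prod p (perm_mat_of n (unit_vec p 0) (0\<^sub>v p) f) A)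
         (t_transpose p (perm_mat_of n (unit_vec p 0) (0\<^sub>v p) f)) =
         four_block_mat B C (zero_tubal_mat p s r) D) \<longleftrightarrow> ?zeros f r s"
    if f: "bij_betw f {..<n} {..<n}" and rs: "r + s = n" for f r s
  proof -
    have fn: "f i < n" if "i < n" for i using bij_betwE[OF f] that by auto
    show ?thesis
      unfolding t_conj_perm_mat_of[OF f assms(3,2)]
      using fn rs vec by (subst tubal_block_triangular_iff) (auto simp: carrier_tubal_def)
  qed
  have "reducible_tubal_mat p n A \<longleftrightarrow>
    (\<exists>P r s. permutation_mat n P \<and> r \<ge> 1 \<and> s \<ge> 1 \<and> r + s = n \<and>
      (\<forall>k<p. \<exists>B C D.
         B \<in> carrier_mat r r \<and> C \<in> carrier_mat r s \<and> D \<in> carrier_mat s s \<and>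
         P * frontal_slice k A * transpose_mat P = four_block_mat B C (0\<^sub>m s r) D))"
    (is "_ \<longleftrightarrow> (\<exists>P r s. _ P \<and> _ r \<and> _ s \<and> _ r s \<and> ?Q P r s)")
  proof -
    have "(\<exists>P r s. permutation_mat n P \<and> r \<ge> 1 \<and> s \<ge> 1 \<and> r + s = n \<and> ?Q P r s) \<longleftrightarrow>
      (\<exists>f r s. bij_betw f {..<n} {..<n} \<and> r \<ge> 1 \<and> s \<ge> 1 \<and> r + s = n \<and>
        ?Q (perm_mat_of n 1 0 f) r s)"
      unfolding permutation_mat_iff by blast
    \<comment> \<open>The equivalence \<open>slice_blocks\<close> presupposes that \<open>f\<close>
      is a bijection and \<open>r + s = n\<close>; \<open>conj_cong\<close> supplies both from the
      preceding conjuncts.\<close>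
    also have "\<dots> \<longleftrightarrow> reducible_tubal_mat p n A"
      unfolding reducible_iff by (simp only: slice_blocks cong: conj_cong)
    finally show ?thesis by simp
  qed
  moreover have "reducible_tubal_mat p n A \<longleftrightarrow>
    (\<exists>P r s B C D. permutation_tubal_mat p n P \<and> r \<ge> 1 \<and> s \<ge> 1 \<and> r + s = n \<and>
       B \<in> carrier_tubal p r r \<and> C \<in> carrier_tubal p r s \<and> D \<in> carrier_tubal p s s \<and>
       t_prod p (t_prod p P A) (t_transpose p P) =
         four_block_mat B C (zero_tubal_mat p s r) D)"
    (is "_ \<longleftrightarrow> (\<exists>P r s B C D. _ P \<and> _ r \<and> _ s \<and> _ r s \<and> ?Q P r s B C D)")
  proof -
    \<comment> \<open>Besides replacing \<open>P\<close> by a bijection, this moves the quantifiers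
      over the blocks inwards, to the form used in \<open>tubal_blocks\<close>.\<close>
    have "(\<exists>P r s B C D. permutation_tubal_mat p n P \<and> r \<ge> 1 \<and> s \<ge> 1 \<and> r + s = n \<and>
        ?Q P r s B C D) \<longleftrightarrow>
      (\<exists>f r s. bij_betw f {..<n} {..<n} \<and> r \<ge> 1 \<and> s \<ge> 1 \<and> r + s = n \<and>
        (\<exists>B C D. ?Q (perm_mat_of n (unit_vec p 0) (0\<^sub>v p) f) r s B C D))"
      unfolding permutation_tubal_mat_iff[OF assms(2)] by blast
    also have "\<dots> \<longleftrightarrow> reducible_tubal_mat p n A"
      unfolding reducible_iff by (simp only: tubal_blocks cong: conj_cong)
    finally show ?thesis by simp
  qed
  \<comment> \<open>In (1) the common block form already gives reducibility of \<open>A\<close>, and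
    \<open>slices_reducible\<close> supplies the other conjunct in the forward direction.\<close>
  ultimately show ?thesis
    using slices_reducible by blast
qed

end
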